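(* For all integers $r,j,n\ge 1$, $$p^r_j(n)=p^r_{j-1}(n)+\sum_{s=0}^{n-1}\binom{n}{s}\,p^r_{j-1}(s)\,p^0_1(n-s).$$
   Context: A preferential arrangement of a finite set $S$ is an ordered set partition of $S$ (a sequence of nonempty pairwise disjoint blocks with union $S$); the empty set has exactly one. Let $a(w)$ be the number of preferential arrangements of a $w$-element set ($a(0)=1$). A barred preferential arrangement of $X_n=\{1,\dots,n\}$ with $k$ bars is a sequence of $k+1$ possibly empty, pairwise disjoint sections with union $X_n$, each equipped with a preferential arrangement of its elements. A restricted section is one whose preferential arrangement has at most one block (exactly one choice); a free section may carry any preferential arrangement. For integers $r,j\ge0$ with $r+j\ge1$, $p^r_j(n)$ is the number of barred preferential arrangements of $X_n$ with $r+j$ sections ($r+j-1$ bars) in which $r$ fixed sections are restricted and $j$ fixed sections are free; equivalently $p^r_j(n)=\sum_{w_1+\cdots+w_{r+j}=n}\frac{n!}{w_1!\cdots w_{r+j}!}\prod_{i=r+1}^{r+j}a(w_i)$ (sum over nonnegative integer solutions). In particular $p^0_1(n)=a(n)$ and $p^r_0(n)=r^n$. *)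

theory Defs
  imports Main "HOL-Library.Disjoint_Sets"
begin

text \<open>An ordered set partition is represented by the list of its blocks; \<open>distinct\<close>, together with
  the disjointness and nonemptiness in \<^const>\<open>partition_on\<close>, makes every block occur exactly once.\<close>

definition preferential_arrangements :: "'a set \<Rightarrow> 'a set list set" where
  "preferential_arrangements S = {Bs. distinct Bs \<and> partition_on S (set Bs)}"

text \<open>With \<open>k\<close> bars: a list of \<open>k + 1\<close> pairs, each consisting of a (possibly empty) section and a
  preferential arrangement of it.\<close>

definition barred_preferential_arrangements ::
    "nat \<Rightarrow> 'a set \<Rightarrow> ('a set \<times> 'a set list) list set" where
  "barred_preferential_arrangements k X =
     {xs. length xs = k + 1 \<and>
          disjoint_family_on (\<lambda>i. fst (xs ! i)) {..<k + 1} \<and>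
          (\<Union>i<k + 1. fst (xs ! i)) = X \<and>
          (\<forall>i<k + 1. snd (xs ! i) \<in> preferential_arrangements (fst (xs ! i)))}"

text \<open>The number \<open>p\<^sup>r\<^sub>j(n)\<close>, for \<open>r + j \<ge> 1\<close> (for \<open>r = j = 0\<close> the truncated subtraction makes the value
  meaningless). The \<open>r\<close> fixed restricted sections are taken to be the first \<open>r\<close> ones; the
  remaining \<open>j\<close> are free.\<close>

definition p :: "nat \<Rightarrow> nat \<Rightarrow> nat \<Rightarrow> nat" where
  "p r j n = card {xs \<in> barred_preferential_arrangements (r + j - 1) {1..n}.
                     \<forall>i<r. length (snd (xs ! i)) \<le> 1}"

end

theory Submission imports Defs begin

text \<open>Cut off the last, free section of a barred preferential arrangement of \<open>X\<close>: what remains is an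
  arrangement, with one bar fewer, of some \<open>S \<subseteq> X\<close>, and the cut-off section is a preferential
  arrangement of \<open>X - S\<close>. Both counts depend only on \<open>card S\<close>, so grouping the subsets of \<open>X\<close> by their
  size gives the binomial sum up to \<open>s = n\<close>; since \<open>a(0) = 1\<close>, the term \<open>s = n\<close> is the one standing
  apart.\<close>

text \<open>The set counted by \<open>p\<close>, but over an arbitrary ground set, because cutting
  off a section leaves an arbitrary subset of \<open>{1..n}\<close>. The number \<open>k\<close> of
  bars is a separate parameter, which keeps truncated subtraction out of the lemmas.\<close>

definition restricted_arrangements :: "nat \<Rightarrow> nat \<Rightarrow> 'a set \<Rightarrow> ('a set \<times> 'a set list) list set" where
  "restricted_arrangements r k X =
     {xs \<in> barred_preferential_arrangements k X. \<forall>i<r. length (snd (xs ! i)) \<le> 1}"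

section \<open>Finiteness of the arrangement sets\<close>

lemma preferential_arrangements_subset:
  "Bs \<in> preferential_arrangements S \<Longrightarrow> set Bs \<subseteq> Pow S"
  by (auto simp: preferential_arrangements_def partition_on_def)

lemma preferential_arrangements_empty: "preferential_arrangements {} = {[]}"
  by (auto simp: preferential_arrangements_def partition_on_empty)

lemma finite_preferential_arrangements:
  assumes "finite S" shows "finite (preferential_arrangements S)"
proof (rule finite_subset)
  show "preferential_arrangements S \<subseteq> {Bs. set Bs \<subseteq> Pow S \<and> distinct Bs}"
    using preferential_arrangements_subset by (auto simp: preferential_arrangements_def)
qed (simp add: assms finite_subset_distinct)

text \<open>Confines the entries to a set that is finite when \<open>X\<close> is. The same bound
  later keeps all sections and blocks inside \<open>X\<close>, where a relabelling is
  injective.\<close>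

lemma barred_preferential_arrangements_subset:
  assumes "xs \<in> barred_preferential_arrangements k X"
  shows "set xs \<subseteq> (SIGMA S : Pow X. preferential_arrangements S)"
proof
  fix x assume "x \<in> set xs"
  then obtain i where "i < k + 1" "x = xs ! i"
    using assms by (auto simp: in_set_conv_nth barred_preferential_arrangements_def)
  then show "x \<in> (SIGMA S : Pow X. preferential_arrangements S)"
    using assms by (cases x) (force simp: barred_preferential_arrangements_def)
qed

lemma finite_restricted_arrangements:
  assumes "finite X" shows "finite (restricted_arrangements r k X)"
proof (rule finite_subset)
  let ?C = "SIGMA S : Pow X. preferential_arrangements S"
  show "restricted_arrangements r k X \<subseteq> {xs. set xs \<subseteq> ?C \<and> length xs = k + 1}"
  proof
    fix xs assume "xs \<in> restricted_arrangements r k X"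
    then have xs: "xs \<in> barred_preferential_arrangements k X"
      by (simp add: restricted_arrangements_def)
    then show "xs \<in> {xs. set xs \<subseteq> ?C \<and> length xs = k + 1}"
      using barred_preferential_arrangements_subset[OF xs]
      by (simp add: barred_preferential_arrangements_def)
  qed
  have "finite ?C"
    using assms by (auto intro!: finite_SigmaI finite_preferential_arrangements dest: finite_subset)
  then show "finite {xs. set xs \<subseteq> ?C \<and> length xs = k + 1}"
    by (rule finite_lists_length_eq)
qed

section \<open>Invariance of the counts under relabelling\<close>

lemma map_image_preferential_arrangements:
  assumes "inj_on f X" "S \<subseteq> X" "Bs \<in> preferential_arrangements S"
  shows "map ((`) f) Bs \<in> preferential_arrangements (f ` S)"
proof -
  have inj: "inj_on f S" using assms by (meson inj_on_subset)
  have "inj_on ((`) f) (set Bs)"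
    using inj_on_image_Pow[OF inj] preferential_arrangements_subset[OF assms(3)]
    by (rule inj_on_subset)
  moreover have "partition_on (f ` S) ((`) f ` set Bs)"
  proof -
    have P: "partition_on S (set Bs)"
      using assms(3) by (simp add: preferential_arrangements_def)
    \<comment> \<open>The library fact on images of partitions removes the empty set; here nothing
      is removed, since no block is empty.\<close>
    then have "(`) f ` set Bs - {{}} = (`) f ` set Bs"
      by (auto simp: partition_on_def)
    then show ?thesis using partition_on_inj_image[OF P inj] by simp
  qed
  ultimately show ?thesis
    using assms(3) by (simp add: preferential_arrangements_def distinct_map)
qed

lemma card_preferential_arrangements_le:
  assumes "inj_on f X" "finite X"
  shows "card (preferential_arrangements X) \<le> card (preferential_arrangements (f ` X))"
proof (rule card_inj_on_le)
  show "inj_on (map ((`) f)) (preferential_arrangements X)"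
    using inj_on_map_lists[OF inj_on_image_Pow[OF assms(1)]]
    by (rule inj_on_subset) (auto dest: preferential_arrangements_subset)
  show "map ((`) f) ` preferential_arrangements X \<subseteq> preferential_arrangements (f ` X)"
    using map_image_preferential_arrangements[OF assms(1)] by auto
qed (simp add: assms finite_preferential_arrangements)

text \<open>Injections in both directions give the two inequalities, so relabelling never has to be
  shown surjective.\<close>

lemma card_preferential_arrangements_cong:
  assumes "finite X" "finite Y" "card X = card Y"
  shows "card (preferential_arrangements X) = card (preferential_arrangements Y)"
proof -
  obtain f g where "bij_betw f X Y" "bij_betw g Y X"
    using assms by (metis finite_same_card_bij)
  then show ?thesis
    using card_preferential_arrangements_le[of f X] card_preferential_arrangements_le[of g Y] assms
    by (simp add: bij_betw_def)
qed

text \<open>Relabelling acts on each section and on each of its blocks at once, and it preserves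
  disjointness and the number of blocks. The bound on \<open>r\<close> makes every index
  \<open>i < r\<close> an actual position in the list.\<close>

lemma card_restricted_arrangements_le:
  assumes "inj_on f X" "finite X" "r \<le> k + 1"
  shows "card (restricted_arrangements r k X) \<le> card (restricted_arrangements r k (f ` X))"
proof (rule card_inj_on_le)
  let ?g = "map_prod ((`) f) (map ((`) f))"
  \<comment> \<open>As \<open>f\<close> is injective only on \<open>X\<close>, injectivity of
    \<open>?g\<close> is available only for sections and blocks inside \<open>X\<close>.\<close>
  have "inj_on ?g (Pow X \<times> lists (Pow X))"
    using inj_on_image_Pow[OF assms(1)] by (intro map_prod_inj_on inj_on_map_lists)
  moreover have "(SIGMA S : Pow X. preferential_arrangements S) \<subseteq> Pow X \<times> lists (Pow X)"
    by (auto dest!: preferential_arrangements_subset)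
  then have "restricted_arrangements r k X \<subseteq> lists (Pow X \<times> lists (Pow X))"
    using barred_preferential_arrangements_subset unfolding restricted_arrangements_def lists_eq_set
    by blast
  ultimately show "inj_on (map ?g) (restricted_arrangements r k X)"
    by (meson inj_on_map_lists inj_on_subset)
  show "map ?g ` restricted_arrangements r k X \<subseteq> restricted_arrangements r k (f ` X)"
  proof
    fix ys assume "ys \<in> map ?g ` restricted_arrangements r k X"
    then obtain xs where xs: "xs \<in> restricted_arrangements r k X" and ys: "ys = map ?g xs"
      by blast
    have len: "length xs = k + 1" and un: "(\<Union>i<k + 1. fst (xs ! i)) = X"
      and disj: "disjoint_family_on (\<lambda>i. fst (xs ! i)) {..<k + 1}"
      and pa: "\<And>i. i < k + 1 \<Longrightarrow> snd (xs ! i) \<in> preferential_arrangements (fst (xs ! i))"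
      and re: "\<And>i. i < r \<Longrightarrow> length (snd (xs ! i)) \<le> 1"
      using xs by (auto simp: restricted_arrangements_def barred_preferential_arrangements_def)
    have nth: "ys ! i = (f ` fst (xs ! i), map ((`) f) (snd (xs ! i)))" if "i < k + 1" for i
      using that len by (simp add: ys map_prod_def split_beta)
    have sub: "fst (xs ! i) \<subseteq> X" if "i < k + 1" for i using that un by blast
    have "disjoint_family_on (\<lambda>i. fst (ys ! i)) {..<k + 1}"
      unfolding disjoint_family_on_def
    proof (intro ballI impI)
      fix i l assume il: "i \<in> {..<k + 1}" "l \<in> {..<k + 1}" "i \<noteq> l"
      then have "fst (xs ! i) \<inter> fst (xs ! l) = {}"
        using disj by (auto simp: disjoint_family_on_def)
      then show "fst (ys ! i) \<inter> fst (ys ! l) = {}"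
        using il sub[of i] sub[of l] nth
        by (simp add: inj_on_image_Int[OF assms(1), symmetric])
    qed
    moreover have "(\<Union>i<k + 1. fst (ys ! i)) = f ` X"
      using nth by (simp add: un[symmetric] image_UN)
    moreover have "snd (ys ! i) \<in> preferential_arrangements (fst (ys ! i))" if "i < k + 1" for i
      using that nth pa sub map_image_preferential_arrangements[OF assms(1)] by simp
    moreover have "length (snd (ys ! i)) \<le> 1" if "i < r" for i
      using that assms(3) nth re by simp
    ultimately show "ys \<in> restricted_arrangements r k (f ` X)"
      using len by (auto simp: restricted_arrangements_def barred_preferential_arrangements_def ys)
  qed
qed (simp add: assms finite_restricted_arrangements)

lemma card_restricted_arrangements_cong:
  assumes "finite X" "finite Y" "card X = card Y" "r \<le> k + 1"
  shows "card (restricted_arrangements r k X) = card (restricted_arrangements r k Y)"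
proof -
  obtain f g where "bij_betw f X Y" "bij_betw g Y X"
    using assms by (metis finite_same_card_bij)
  then show ?thesis
    using card_restricted_arrangements_le[of f X r k] card_restricted_arrangements_le[of g Y r k] assms
    by (simp add: bij_betw_def)
qed

section \<open>Cutting off the last section\<close>

lemma snoc_barred_preferential_arrangements_iff:
  "ys @ [(T, Bs)] \<in> barred_preferential_arrangements (Suc k) X \<longleftrightarrow>
     T \<subseteq> X \<and> ys \<in> barred_preferential_arrangements k (X - T) \<and> Bs \<in> preferential_arrangements T"
proof (cases "length ys = Suc k")
  case True
  let ?F = "\<lambda>i. fst (ys ! i)" and ?G = "\<lambda>i. fst ((ys @ [(T, Bs)]) ! i)"
  have G: "?G (Suc k) = T" "\<And>i. i < Suc k \<Longrightarrow> ?G i = ?F i"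
    using True by (auto simp: nth_append)
  have "disjoint_family_on ?G {..<Suc (Suc k)} \<longleftrightarrow>
      T \<inter> (\<Union>i<Suc k. ?G i) = {} \<and> disjoint_family_on ?G {..<Suc k}"
    by (simp add: lessThan_Suc[of "Suc k"] disjoint_family_on_insert G(1))
  also have "(\<Union>i<Suc k. ?G i) = (\<Union>i<Suc k. ?F i)"
    using G(2) by (intro SUP_cong) auto
  also have "disjoint_family_on ?G {..<Suc k} \<longleftrightarrow> disjoint_family_on ?F {..<Suc k}"
    using G(2) by (auto simp: disjoint_family_on_def)
  finally have disj: "disjoint_family_on ?G {..<Suc (Suc k)} \<longleftrightarrow>
      T \<inter> (\<Union>i<Suc k. ?F i) = {} \<and> disjoint_family_on ?F {..<Suc k}" .
  have un: "(\<Union>i<Suc (Suc k). ?G i) = T \<union> (\<Union>i<Suc k. ?F i)"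
    using G by (simp add: lessThan_Suc[of "Suc k"] cong: SUP_cong_simp)
  have all: "(\<forall>i<Suc (Suc k). snd ((ys @ [(T, Bs)]) ! i) \<in> preferential_arrangements (?G i)) \<longleftrightarrow>
      Bs \<in> preferential_arrangements T \<and>
      (\<forall>i<Suc k. snd (ys ! i) \<in> preferential_arrangements (?F i))"
    using True by (auto simp: nth_append less_Suc_eq)
  \<comment> \<open>With \<open>U\<close> the union of the sections of \<open>ys\<close>,
    disjointness from \<open>T\<close> and covering of \<open>X\<close> together say that
    \<open>ys\<close> has ground set \<open>X - T\<close>.\<close>
  have "T \<inter> U = {} \<and> T \<union> U = X \<longleftrightarrow> T \<subseteq> X \<and> U = X - T" for U by blast
  then show ?thesis
    unfolding barred_preferential_arrangements_def mem_Collect_eq Suc_eq_plus1[symmetric] disj un all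
    using True by auto
\<comment> \<open>For any other length of \<open>ys\<close>, both sides are false.\<close>
qed (auto simp: barred_preferential_arrangements_def)

text \<open>As \<open>r \<le> k + 1\<close>, the appended section has index at least
  \<open>r\<close> and is free, so the restrictions concern \<open>ys\<close> alone.\<close>

lemma snoc_restricted_arrangements_iff:
  assumes "r \<le> k + 1"
  shows "ys @ [(T, Bs)] \<in> restricted_arrangements r (Suc k) X \<longleftrightarrow>
     T \<subseteq> X \<and> ys \<in> restricted_arrangements r k (X - T) \<and> Bs \<in> preferential_arrangements T"
proof -
  have "(\<forall>i<r. length (snd ((ys @ [(T, Bs)]) ! i)) \<le> 1) \<longleftrightarrow> (\<forall>i<r. length (snd (ys ! i)) \<le> 1)"
    if "ys \<in> barred_preferential_arrangements k (X - T)"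
    using that assms by (auto simp: barred_preferential_arrangements_def nth_append)
  then show ?thesis
    unfolding restricted_arrangements_def mem_Collect_eq snoc_barred_preferential_arrangements_iff
    by blast
qed

text \<open>The index \<open>S\<close> is the ground set of what remains, so the cut-off section is
  \<open>X - S\<close>; this matches the summation index \<open>s\<close> of the theorem with
  \<open>card S\<close>.\<close>

lemma bij_betw_snoc_restricted_arrangements:
  assumes "r \<le> k + 1"
  shows "bij_betw (\<lambda>(S, ys, Bs). ys @ [(X - S, Bs)])
    (SIGMA S : Pow X. restricted_arrangements r k S \<times> preferential_arrangements (X - S))
    (restricted_arrangements r (Suc k) X)"
    (is "bij_betw ?h ?D ?R")
  unfolding bij_betw_def
proof (rule conjI)
  have inv: "X - (X - S) = S" if "S \<subseteq> X" for S using that by blast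
  show "inj_on ?h ?D"
  proof (rule inj_onI)
    fix x y assume "x \<in> ?D" "y \<in> ?D" "?h x = ?h y"
    then show "x = y" by (cases x; cases y) (clarsimp, metis inv)
  qed
  show "?h ` ?D = ?R"
  proof (intro subset_antisym subsetI)
    fix xs assume "xs \<in> ?h ` ?D"
    then show "xs \<in> ?R"
      by (auto simp: snoc_restricted_arrangements_iff[OF assms] inv)
  next
    fix xs assume xs: "xs \<in> ?R"
    then have "xs \<noteq> []"
      by (auto simp: restricted_arrangements_def barred_preferential_arrangements_def)
    then obtain ys T Bs where eq: "xs = ys @ [(T, Bs)]"
      by (metis rev_exhaust surj_pair)
    have T: "T \<subseteq> X" "ys \<in> restricted_arrangements r k (X - T)" "Bs \<in> preferential_arrangements T"
      using xs by (simp_all add: eq snoc_restricted_arrangements_iff[OF assms])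
    show "xs \<in> ?h ` ?D"
      by (rule image_eqI[of _ _ "(X - T, ys, Bs)"]) (simp_all add: eq T inv Diff_subset)
  qed
qed

section \<open>Counting\<close>

lemma card_restricted_arrangements_Suc:
  assumes "finite X" "r \<le> k + 1"
  shows "card (restricted_arrangements r (Suc k) X) =
    (\<Sum>S\<in>Pow X. card (restricted_arrangements r k S) * card (preferential_arrangements (X - S)))"
proof -
  have "finite S" if "S \<in> Pow X" for S using that assms(1) finite_subset by auto
  then show ?thesis
    using assms
    by (subst bij_betw_same_card[OF bij_betw_snoc_restricted_arrangements[OF assms(2)], symmetric],
        subst card_SigmaI)
      (auto simp: card_cartesian_product
        intro!: finite_restricted_arrangements finite_preferential_arrangements)
qed

text \<open>Subsets are grouped by size; each size \<open>s\<close> contributes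
  \<open>card X choose s\<close> equal terms.\<close>

lemma sum_Pow_card:
  fixes g :: "nat \<Rightarrow> nat"
  assumes "finite X"
  shows "(\<Sum>S\<in>Pow X. g (card S)) = (\<Sum>s=0..card X. (card X choose s) * g s)"
proof -
  have "(\<Sum>S\<in>Pow X. g (card S)) = (\<Sum>s=0..card X. \<Sum>S\<in>{S\<in>Pow X. card S = s}. g (card S))"
    using assms by (intro sum.group[symmetric]) (auto intro: card_mono)
  also have "\<dots> = (\<Sum>s=0..card X. (card X choose s) * g s)"
    using n_subsets[OF assms] by (intro sum.cong) auto
  finally show ?thesis .
qed

lemma p_eq_card_restricted_arrangements:
  "p r j n = card (restricted_arrangements r (r + j - 1) {1..n})"
  by (simp add: p_def restricted_arrangements_def)

text \<open>Without bars, the single section is forced to be the whole ground set, and with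
  \<open>r = 0\<close> it is unrestricted.\<close>

lemma p_0_1_eq_card: "p 0 1 m = card (preferential_arrangements {1..m})"
proof -
  have "restricted_arrangements 0 0 {1..m} =
      (\<lambda>Bs. [({1..m}, Bs)]) ` preferential_arrangements {1..m}"
    by (auto simp: restricted_arrangements_def barred_preferential_arrangements_def
        disjoint_family_on_def length_Suc_conv lessThan_Suc)
  then show ?thesis
    by (simp add: p_eq_card_restricted_arrangements card_image inj_on_def)
qed

theorem theorem6:
  fixes r j n :: nat
  assumes "r \<ge> 1" and "j \<ge> 1" and "n \<ge> 1"
  shows "p r j n = p r (j - 1) n + (\<Sum>s = 0..n - 1. (n choose s) * p r (j - 1) s * p 0 1 (n - s))"
proof -
  \<comment> \<open>The number of bars in \<open>p r (j - 1)\<close>. Since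
    \<open>r \<ge> 1\<close>, the subtraction is exact even for \<open>j = 1\<close>, where no free
    section remains.\<close>
  define k where "k = r + (j - 1) - 1"
  have k: "r + j - 1 = Suc k" "r \<le> k + 1" using assms by (auto simp: k_def)
  \<comment> \<open>Both factors are moved to initial segments, where \<open>p\<close> is defined:
    \<open>S\<close> is replaced by \<open>{1..card S}\<close> and its complement by
    \<open>{1..n - card S}\<close>.\<close>
  have "card (restricted_arrangements r k S) * card (preferential_arrangements ({1..n} - S)) =
      p r (j - 1) (card S) * p 0 1 (n - card S)" if "S \<in> Pow {1..n}" for S
  proof -
    have "finite S" using that finite_subset by auto
    moreover have "card ({1..n} - S) = n - card S"
      using that \<open>finite S\<close> by (simp add: card_Diff_subset)
    ultimately show ?thesis
      unfolding p_0_1_eq_card p_eq_card_restricted_arrangements[of r] k_def[symmetric]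
      using k(2)
      by (intro arg_cong2[where f = "(*)"] card_restricted_arrangements_cong
          card_preferential_arrangements_cong) auto
  qed
  then have "p r j n = (\<Sum>S\<in>Pow {1..n}. p r (j - 1) (card S) * p 0 1 (n - card S))"
    unfolding p_eq_card_restricted_arrangements[of r j] k(1)
    by (simp add: card_restricted_arrangements_Suc[OF _ k(2)])
  also have "\<dots> = (\<Sum>s=0..n. (n choose s) * p r (j - 1) s * p 0 1 (n - s))"
    using sum_Pow_card[of "{1..n}" "\<lambda>s. p r (j - 1) s * p 0 1 (n - s)"] by (simp add: mult.assoc)
  also have "\<dots> = p r (j - 1) n + (\<Sum>s = 0..n - 1. (n choose s) * p r (j - 1) s * p 0 1 (n - s))"
    \<comment> \<open>The term \<open>s = n\<close> has binomial coefficient 1 and factor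
      \<open>p 0 1 0 = 1\<close>. Here \<open>n \<ge> 1\<close> matters: for \<open>n = 0\<close>
      the range \<open>0..n - 1\<close> would still contain \<open>s = 0\<close>.\<close>
    using assms(3) p_0_1_eq_card[of 0]
    by (cases n) (simp_all add: preferential_arrangements_empty)
  finally show ?thesis .
qed

end
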